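(* Let $\mathcal O$ be a discrete set and let $F$ be a filter basis on $\mathcal O$. A function $f:\mathcal O\to\mathbb R$ is $F$-convergent if and only if $f\in\mathrm{Dar}(\psi_F)$. Moreover, $\mathrm{ex}_{\psi_F}(f)=\lim_F(f)$ for all $f\in\mathrm{Dar}(\psi_F)$.
   Context: A discrete set is an ordered set with the trivial order ($x\le y$ iff $x=y$), so every function $f:\mathcal O\to\mathbb R$ is order preserving. $\mathrm{OP}(\mathcal O,\mathbb R)$ is the set of order preserving functions $\mathcal O\to\mathbb R$ (here: all functions), ordered pointwise. $\widehat{\mathbb R}=\mathbb R\cup\{\pm\infty\}$ is the ordered set of extended real numbers. A filter basis on $\mathcal O$ is a collection $F$ of nonempty subsets of $\mathcal O$ that is closed under finite intersections. A partial function $\psi:\mathcal A\rightharpoonup\mathcal P$ between ordered sets is an order preserving function $\psi:\mathrm{dom}(\psi)\to\mathcal P$ defined on a subset $\mathrm{dom}(\psi)\subseteq\mathcal A$ with the induced order. An extension of $\psi$ to $\mathcal A$ is an order preserving function $f:\mathcal A\to\mathcal P$ whose restriction to $\mathrm{dom}(\psi)$ is $\psi$. $\psi$ is extremizable if there exist extensions $\mathrm{lex}_\psi,\mathrm{uex}_\psi:\mathcal A\to\mathcal P$ of $\psi$ (the lower and upper extensions) with $\mathrm{lex}_\psi\le f\le\mathrm{uex}_\psi$ pointwise for every extension $f$ of $\psi$ to $\mathcal A$. In that case $\mathrm{Dar}(\psi)=\{x\in\mathcal A\mid\mathrm{lex}_\psi(x)=\mathrm{uex}_\psi(x)\}$ is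 the Darboux set of $\psi$ and $\mathrm{ex}_\psi$ denotes the common restriction of $\mathrm{lex}_\psi$ and $\mathrm{uex}_\psi$ to $\mathrm{Dar}(\psi)$. Every partial function with codomain $\widehat{\mathbb R}$ is extremizable. For a nonempty $\mathcal S\subseteq\mathcal O$, let $\psi_{\mathcal S}:\mathrm{OP}(\mathcal O,\mathbb R)\rightharpoonup\widehat{\mathbb R}$ be the partial function whose domain is the set of functions that are constant on $\mathcal S$, with $\psi_{\mathcal S}(f)=f(x)$ for any $x\in\mathcal S$. The partial function $\psi_F:\mathrm{OP}(\mathcal O,\mathbb R)\rightharpoonup\widehat{\mathbb R}$ has domain $\bigcup_{\mathcal S\in F}\mathrm{dom}(\psi_{\mathcal S})$ and is given by $\psi_F(f)=\psi_{\mathcal S}(f)$ for each $\mathcal S\in F$ and each $f\in\mathrm{dom}(\psi_{\mathcal S})$. A function $f:\mathcal O\to\mathbb R$ is $F$-convergent if there exists $\lim_F(f)\in\widehat{\mathbb R}$ such that every neighborhood of $\lim_F(f)$ contains $f(\mathcal S)$ for some $\mathcal S\in F$. That is: if $\lim_F(f)\in\mathbb R$, then for every $\varepsilon>0$ there exists $\mathcal S\in F$ with $f(x)\in[\lim_F(f)-\varepsilon,\lim_F(f)+\varepsilon]$ for all $x\in\mathcal S$; if $\lim_F(f)=+\infty$ (resp. $-\infty$), then for every $M\in\mathbb R$ there exists $\mathcal S\in F$ with $f(x)\ge M$ (resp. $f(x)\le M$) for all $x\in\mathcal S$. *)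

theory Defs
  imports "HOL-Analysis.Analysis"
begin

section \<open>Partial functions and their extremal extensions\<close>

text \<open>
  An ordered set is a subset \<open>A\<close> of an ordered type, with the induced order; functions with
  domain \<open>A\<close> are elements of \<open>extensional A\<close>, so that they are determined by their values on \<open>A\<close>.
\<close>

definition partial_function_on :: "'a::order set \<Rightarrow> ('a \<rightharpoonup> 'b::order) \<Rightarrow> bool" where
  "partial_function_on A \<psi> \<longleftrightarrow> dom \<psi> \<subseteq> A \<and> mono_on (dom \<psi>) (\<lambda>x. the (\<psi> x))"

definition is_extension :: "'a::order set \<Rightarrow> ('a \<rightharpoonup> 'b::order) \<Rightarrow> ('a \<Rightarrow> 'b) \<Rightarrow> bool" where
  "is_extension A \<psi> f \<longleftrightarrow>
     f \<in> extensional A \<and> mono_on A f \<and> (\<forall>x\<in>dom \<psi>. \<psi> x = Some (f x))"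

definition is_lower_extension :: "'a::order set \<Rightarrow> ('a \<rightharpoonup> 'b::order) \<Rightarrow> ('a \<Rightarrow> 'b) \<Rightarrow> bool" where
  "is_lower_extension A \<psi> l \<longleftrightarrow>
     is_extension A \<psi> l \<and> (\<forall>f. is_extension A \<psi> f \<longrightarrow> (\<forall>x\<in>A. l x \<le> f x))"

definition is_upper_extension :: "'a::order set \<Rightarrow> ('a \<rightharpoonup> 'b::order) \<Rightarrow> ('a \<Rightarrow> 'b) \<Rightarrow> bool" where
  "is_upper_extension A \<psi> u \<longleftrightarrow>
     is_extension A \<psi> u \<and> (\<forall>f. is_extension A \<psi> f \<longrightarrow> (\<forall>x\<in>A. f x \<le> u x))"

definition extremizable :: "'a::order set \<Rightarrow> ('a \<rightharpoonup> 'b::order) \<Rightarrow> bool" where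
  "extremizable A \<psi> \<longleftrightarrow> (\<exists>l. is_lower_extension A \<psi> l) \<and> (\<exists>u. is_upper_extension A \<psi> u)"

text \<open>
  The following four notions are meaningful for extremizable \<open>\<psi>\<close> only; the descriptions are then
  well defined by \<open>lex_equality\<close> and \<open>uex_equality\<close> below.
\<close>

definition lex :: "'a::order set \<Rightarrow> ('a \<rightharpoonup> 'b::order) \<Rightarrow> 'a \<Rightarrow> 'b" where
  "lex A \<psi> = (THE l. is_lower_extension A \<psi> l)"

definition uex :: "'a::order set \<Rightarrow> ('a \<rightharpoonup> 'b::order) \<Rightarrow> 'a \<Rightarrow> 'b" where
  "uex A \<psi> = (THE u. is_upper_extension A \<psi> u)"

definition Dar :: "'a::order set \<Rightarrow> ('a \<rightharpoonup> 'b::order) \<Rightarrow> 'a set" where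
  "Dar A \<psi> = {x \<in> A. lex A \<psi> x = uex A \<psi> x}"

definition ex_ext :: "'a::order set \<Rightarrow> ('a \<rightharpoonup> 'b::order) \<Rightarrow> 'a \<Rightarrow> 'b" where
  "ex_ext A \<psi> = restrict (lex A \<psi>) (Dar A \<psi>)"

lemma lex_equality:
  assumes "is_lower_extension A \<psi> l"
  shows "lex A \<psi> = l"
  unfolding lex_def
proof (rule the_equality)
  show "is_lower_extension A \<psi> l" by (rule assms)
  fix k assume k: "is_lower_extension A \<psi> k"
  show "k = l"
  proof (rule extensionalityI[of _ A])
    show "k \<in> extensional A" "l \<in> extensional A"
      using k assms by (auto simp: is_lower_extension_def is_extension_def)
    show "k x = l x" if "x \<in> A" for x
      using k assms that unfolding is_lower_extension_def by (meson order_antisym)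
  qed
qed

lemma uex_equality:
  assumes "is_upper_extension A \<psi> u"
  shows "uex A \<psi> = u"
  unfolding uex_def
proof (rule the_equality)
  show "is_upper_extension A \<psi> u" by (rule assms)
  fix k assume k: "is_upper_extension A \<psi> k"
  show "k = u"
  proof (rule extensionalityI[of _ A])
    show "k \<in> extensional A" "u \<in> extensional A"
      using k assms by (auto simp: is_upper_extension_def is_extension_def)
    show "k x = u x" if "x \<in> A" for x
      using k assms that unfolding is_upper_extension_def by (meson order_antisym)
  qed
qed

lemma is_lower_extension_Sup:
  fixes \<psi> :: "'a::order \<rightharpoonup> 'b::complete_lattice"
  assumes "partial_function_on A \<psi>"
  shows "is_lower_extension A \<psi> (\<lambda>x\<in>A. SUP y\<in>{y \<in> dom \<psi>. y \<le> x}. the (\<psi> y))"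
    (is "is_lower_extension A \<psi> ?l")
proof -
  have dA: "dom \<psi> \<subseteq> A" and mono: "\<And>x y. x \<in> dom \<psi> \<Longrightarrow> y \<in> dom \<psi> \<Longrightarrow> x \<le> y \<Longrightarrow> the (\<psi> x) \<le> the (\<psi> y)"
    using assms by (auto simp: partial_function_on_def mono_on_def)
  have "mono_on A ?l"
  proof (rule mono_onI)
    fix x y assume "x \<in> A" "y \<in> A" "x \<le> y"
    then show "?l x \<le> ?l y"
      by (simp, intro SUP_subset_mono) (auto intro: order_trans)
  qed
  moreover have "\<psi> x = Some (?l x)" if x: "x \<in> dom \<psi>" for x
  proof -
    have "(SUP y\<in>{y \<in> dom \<psi>. y \<le> x}. the (\<psi> y)) = the (\<psi> x)"
      by (rule antisym) (use x in \<open>auto intro!: SUP_least SUP_upper mono\<close>)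
    then show ?thesis using x dA by auto
  qed
  moreover have "?l x \<le> f x" if f: "is_extension A \<psi> f" and x: "x \<in> A" for f x
  proof -
    have "the (\<psi> y) \<le> f x" if "y \<in> dom \<psi>" "y \<le> x" for y
    proof -
      have "the (\<psi> y) = f y" using f that by (auto simp: is_extension_def)
      also have "\<dots> \<le> f x" using f that x dA by (auto simp: is_extension_def mono_on_def)
      finally show ?thesis .
    qed
    then show ?thesis using x by (auto intro!: SUP_least)
  qed
  moreover have "?l \<in> extensional A" by simp
  ultimately show ?thesis
    unfolding is_lower_extension_def is_extension_def by blast
qed

lemma is_upper_extension_Inf:
  fixes \<psi> :: "'a::order \<rightharpoonup> 'b::complete_lattice"
  assumes "partial_function_on A \<psi>"
  shows "is_upper_extension A \<psi> (\<lambda>x\<in>A. INF y\<in>{y \<in> dom \<psi>. x \<le> y}. the (\<psi> y))"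
    (is "is_upper_extension A \<psi> ?u")
proof -
  have dA: "dom \<psi> \<subseteq> A" and mono: "\<And>x y. x \<in> dom \<psi> \<Longrightarrow> y \<in> dom \<psi> \<Longrightarrow> x \<le> y \<Longrightarrow> the (\<psi> x) \<le> the (\<psi> y)"
    using assms by (auto simp: partial_function_on_def mono_on_def)
  have "mono_on A ?u"
  proof (rule mono_onI)
    fix x y assume "x \<in> A" "y \<in> A" "x \<le> y"
    then show "?u x \<le> ?u y"
      by (simp, intro INF_superset_mono) (auto intro: order_trans)
  qed
  moreover have "\<psi> x = Some (?u x)" if x: "x \<in> dom \<psi>" for x
  proof -
    have "(INF y\<in>{y \<in> dom \<psi>. x \<le> y}. the (\<psi> y)) = the (\<psi> x)"
      by (rule antisym) (use x in \<open>auto intro!: INF_greatest INF_lower mono\<close>)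
    then show ?thesis using x dA by auto
  qed
  moreover have "f x \<le> ?u x" if f: "is_extension A \<psi> f" and x: "x \<in> A" for f x
  proof -
    have "f x \<le> the (\<psi> y)" if "y \<in> dom \<psi>" "x \<le> y" for y
    proof -
      have "f x \<le> f y" using f that x dA by (auto simp: is_extension_def mono_on_def)
      also have "f y = the (\<psi> y)" using f that by (auto simp: is_extension_def)
      finally show ?thesis .
    qed
    then show ?thesis using x by (auto intro!: INF_greatest)
  qed
  moreover have "?u \<in> extensional A" by simp
  ultimately show ?thesis
    unfolding is_upper_extension_def is_extension_def by blast
qed

lemma extremizable_complete_lattice:
  fixes \<psi> :: "'a::order \<rightharpoonup> 'b::complete_lattice"
  shows "partial_function_on A \<psi> \<Longrightarrow> extremizable A \<psi>"
  using is_lower_extension_Sup is_upper_extension_Inf unfolding extremizable_def by blast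


section \<open>Discrete sets, filter bases and limits\<close>

definition discrete_set :: "'a set \<Rightarrow> ('a \<Rightarrow> 'a \<Rightarrow> bool) \<Rightarrow> bool" where
  "discrete_set X le \<longleftrightarrow> (\<forall>x\<in>X. \<forall>y\<in>X. le x y \<longleftrightarrow> x = y)"

text \<open>
  The order of the function type compares elements of \<open>OP X le\<close> pointwise on \<open>X\<close>, since they all
  agree outside \<open>X\<close>.
\<close>

definition OP :: "'a set \<Rightarrow> ('a \<Rightarrow> 'a \<Rightarrow> bool) \<Rightarrow> ('a \<Rightarrow> real) set" where
  "OP X le = {f \<in> extensional X. monotone_on X le (\<le>) f}"

lemma OP_le_iff:
  assumes "f \<in> OP X le" "g \<in> OP X le"
  shows "f \<le> g \<longleftrightarrow> (\<forall>x\<in>X. f x \<le> g x)"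
  using assms by (auto simp: OP_def extensional_def le_fun_def)

lemma OP_discrete: "discrete_set X le \<Longrightarrow> OP X le = X \<rightarrow>\<^sub>E UNIV"
  by (auto simp: OP_def discrete_set_def monotone_on_def PiE_def)

text \<open>Only intersections of nonempty families are required to belong to the collection.\<close>

definition filter_basis :: "'a set \<Rightarrow> 'a set set \<Rightarrow> bool" where
  "filter_basis X F \<longleftrightarrow>
     (\<forall>S\<in>F. S \<subseteq> X \<and> S \<noteq> {}) \<and> (\<forall>G. G \<subseteq> F \<and> finite G \<and> G \<noteq> {} \<longrightarrow> \<Inter>G \<in> F)"

definition psi_set :: "'a set \<Rightarrow> ('a \<Rightarrow> 'a \<Rightarrow> bool) \<Rightarrow> 'a set \<Rightarrow> ('a \<Rightarrow> real) \<rightharpoonup> ereal" where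
  "psi_set X le S f =
     (if f \<in> OP X le \<and> f constant_on S then Some (ereal (f (SOME x. x \<in> S))) else None)"

definition psi_basis :: "'a set \<Rightarrow> ('a \<Rightarrow> 'a \<Rightarrow> bool) \<Rightarrow> 'a set set \<Rightarrow> ('a \<Rightarrow> real) \<rightharpoonup> ereal" where
  "psi_basis X le F f =
     (if f \<in> (\<Union>S\<in>F. dom (psi_set X le S))
      then Some (THE c. \<exists>S\<in>F. psi_set X le S f = Some c) else None)"

definition is_limit :: "'a set set \<Rightarrow> ('a \<Rightarrow> real) \<Rightarrow> ereal \<Rightarrow> bool" where
  "is_limit F f L \<longleftrightarrow> (\<forall>N. open N \<and> L \<in> N \<longrightarrow> (\<exists>S\<in>F. (\<lambda>x. ereal (f x)) ` S \<subseteq> N))"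

definition F_convergent :: "'a set set \<Rightarrow> ('a \<Rightarrow> real) \<Rightarrow> bool" where
  "F_convergent F f \<longleftrightarrow> (\<exists>L. is_limit F f L)"

definition F_lim :: "'a set set \<Rightarrow> ('a \<Rightarrow> real) \<Rightarrow> ereal" where
  "F_lim F f = (THE L. is_limit F f L)"

lemma filter_basis_Int:
  assumes "filter_basis X F" "S \<in> F" "T \<in> F"
  shows "S \<inter> T \<in> F" "S \<inter> T \<noteq> {}"
proof -
  have "\<Inter>{S, T} \<in> F" using assms unfolding filter_basis_def by (metis empty_subsetI finite.simps insert_not_empty insert_subset)
  then show "S \<inter> T \<in> F" by simp
  then show "S \<inter> T \<noteq> {}" using assms unfolding filter_basis_def by blast
qed

lemma psi_set_eq:
  assumes "f \<in> dom (psi_set X le S)" "x \<in> S"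
  shows "psi_set X le S f = Some (ereal (f x))"
proof -
  have "(SOME x. x \<in> S) \<in> S" using assms(2) by (rule someI)
  then show ?thesis using assms by (auto simp: psi_set_def constant_on_def split: if_splits)
qed

lemma psi_basis_eq:
  assumes F: "filter_basis X F" and S: "S \<in> F" "f \<in> dom (psi_set X le S)"
  shows "psi_basis X le F f = psi_set X le S f"
proof -
  obtain c where c: "psi_set X le S f = Some c" using S by auto
  have "d = c" if T: "T \<in> F" "psi_set X le T f = Some d" for T d
  proof -
    obtain x where "x \<in> S \<inter> T" using filter_basis_Int(2)[OF F S(1) T(1)] by blast
    then show ?thesis using psi_set_eq[of f X le S x] psi_set_eq[of f X le T x] c T by auto
  qed
  then have "(THE c. \<exists>S\<in>F. psi_set X le S f = Some c) = c"
    using c S(1) by (intro the_equality) blast+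
  moreover have "f \<in> (\<Union>S\<in>F. dom (psi_set X le S))" using S by (rule UN_I)
  ultimately show ?thesis by (simp add: psi_basis_def c)
qed

lemma dom_psi_basis: "dom (psi_basis X le F) = (\<Union>S\<in>F. dom (psi_set X le S))"
  by (auto simp: psi_basis_def dom_def)

lemma partial_function_on_psi_basis:
  assumes F: "filter_basis X F"
  shows "partial_function_on (OP X le) (psi_basis X le F)"
  unfolding partial_function_on_def
proof
  show "dom (psi_basis X le F) \<subseteq> OP X le"
    by (auto simp: dom_psi_basis psi_set_def split: if_splits)
  show "mono_on (dom (psi_basis X le F)) (\<lambda>f. the (psi_basis X le F f))"
  proof (rule mono_onI)
    fix f g assume f: "f \<in> dom (psi_basis X le F)" and g: "g \<in> dom (psi_basis X le F)" and "f \<le> g"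
    obtain S where S: "S \<in> F" "f \<in> dom (psi_set X le S)" using f dom_psi_basis by blast
    obtain T where T: "T \<in> F" "g \<in> dom (psi_set X le T)" using g dom_psi_basis by blast
    obtain x where x: "x \<in> S" "x \<in> T" using filter_basis_Int(2)[OF F S(1) T(1)] by blast
    have "f x \<le> g x" using \<open>f \<le> g\<close> by (simp add: le_fun_def)
    then show "the (psi_basis X le F f) \<le> the (psi_basis X le F g)"
      by (simp add: psi_basis_eq[OF F S] psi_basis_eq[OF F T] psi_set_eq[OF S(2) x(1)]
          psi_set_eq[OF T(2) x(2)])
  qed
qed

lemma is_limitD:
  assumes "is_limit F f L" "open N" "L \<in> N"
  shows "\<exists>S\<in>F. \<forall>x\<in>S. ereal (f x) \<in> N"
  using assms unfolding is_limit_def by (simp add: image_subset_iff)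

lemma is_limitI:
  assumes "\<And>N. open N \<Longrightarrow> L \<in> N \<Longrightarrow> \<exists>S\<in>F. \<forall>x\<in>S. ereal (f x) \<in> N"
  shows "is_limit F f L"
  using assms unfolding is_limit_def by (simp add: image_subset_iff)

lemma is_limit_unique:
  assumes F: "filter_basis X F" and L: "is_limit F f L" and M: "is_limit F f M"
  shows "L = M"
proof (rule ccontr)
  assume "L \<noteq> M"
  then obtain U V where UV: "open U" "open V" "L \<in> U" "M \<in> V" "U \<inter> V = {}"
    using hausdorff[of L M] by auto
  obtain S where S: "S \<in> F" "\<forall>x\<in>S. ereal (f x) \<in> U"
    using is_limitD[OF L UV(1) UV(3)] by meson
  obtain T where T: "T \<in> F" "\<forall>x\<in>T. ereal (f x) \<in> V"
    using is_limitD[OF M UV(2) UV(4)] by meson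
  obtain x where "x \<in> S" "x \<in> T"
    using filter_basis_Int(2)[OF F S(1) T(1)] by auto
  with S(2) T(2) UV(5) show False by (meson disjoint_iff)
qed

lemma F_lim_equality:
  assumes "filter_basis X F" "is_limit F f L"
  shows "F_lim F f = L"
  unfolding F_lim_def using is_limit_unique[OF assms(1) _ assms(2)] assms(2)
  by (rule the_equality[rotated])

lemma is_limit_ereal_iff:
  "is_limit F f (ereal r) \<longleftrightarrow> (\<forall>e>0. \<exists>S\<in>F. \<forall>x\<in>S. f x \<in> {r - e..r + e})"
proof
  assume L: "is_limit F f (ereal r)"
  show "\<forall>e>0. \<exists>S\<in>F. \<forall>x\<in>S. f x \<in> {r - e..r + e}"
  proof (intro allI impI)
    fix e :: real assume "e > 0"
    then have r: "ereal r \<in> {ereal (r - e)<..<ereal (r + e)}" by simp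
    obtain S where S: "S \<in> F" "\<forall>x\<in>S. ereal (f x) \<in> {ereal (r - e)<..<ereal (r + e)}"
      using is_limitD[OF L open_greaterThanLessThan r] by meson
    have "f x \<in> {r - e..r + e}" if "x \<in> S" for x
      using bspec[OF S(2) that] by simp
    with S(1) show "\<exists>S\<in>F. \<forall>x\<in>S. f x \<in> {r - e..r + e}" by blast
  qed
next
  assume R: "\<forall>e>0. \<exists>S\<in>F. \<forall>x\<in>S. f x \<in> {r - e..r + e}"
  show "is_limit F f (ereal r)"
  proof (rule is_limitI)
    fix N :: "ereal set" assume "open N" "ereal r \<in> N"
    then have "open (ereal -` N)" "r \<in> ereal -` N" by (simp_all add: open_ereal_vimage)
    then obtain e where e: "e > 0" "cball r e \<subseteq> ereal -` N"
      by (meson open_contains_cball)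
    obtain S where S: "S \<in> F" "\<forall>x\<in>S. f x \<in> {r - e..r + e}" using R e(1) by meson
    have "ereal (f x) \<in> N" if "x \<in> S" for x
    proof -
      have "f x \<in> cball r e" using S(2) that by (simp add: cball_eq_atLeastAtMost)
      then show ?thesis using e(2) by (simp add: subset_iff)
    qed
    then show "\<exists>S\<in>F. \<forall>x\<in>S. ereal (f x) \<in> N" using S(1) by blast
  qed
qed

lemma is_limit_PInfty_iff: "is_limit F f \<infinity> \<longleftrightarrow> (\<forall>M. \<exists>S\<in>F. \<forall>x\<in>S. f x \<ge> M)"
proof
  assume L: "is_limit F f \<infinity>"
  show "\<forall>M. \<exists>S\<in>F. \<forall>x\<in>S. f x \<ge> M"
  proof
    fix M
    have M: "\<infinity> \<in> {ereal M<..}" by simp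
    obtain S where S: "S \<in> F" "\<forall>x\<in>S. ereal (f x) \<in> {ereal M<..}"
      using is_limitD[OF L open_greaterThan M] by meson
    have "f x \<ge> M" if "x \<in> S" for x
      using bspec[OF S(2) that] by simp
    with S(1) show "\<exists>S\<in>F. \<forall>x\<in>S. f x \<ge> M" by blast
  qed
next
  assume R: "\<forall>M. \<exists>S\<in>F. \<forall>x\<in>S. f x \<ge> M"
  show "is_limit F f \<infinity>"
  proof (rule is_limitI)
    fix N :: "ereal set" assume "open N" "\<infinity> \<in> N"
    then obtain M where M: "{ereal M<..} \<subseteq> N" using open_PInfty2 by metis
    obtain S where S: "S \<in> F" "\<forall>x\<in>S. f x \<ge> M + 1" using R by meson
    have "ereal (f x) \<in> N" if "x \<in> S" for x
    proof -
      have "f x \<ge> M + 1" using S(2) that by blast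
      then have "ereal (f x) \<in> {ereal M<..}" by simp
      then show ?thesis using M by blast
    qed
    then show "\<exists>S\<in>F. \<forall>x\<in>S. ereal (f x) \<in> N" using S(1) by blast
  qed
qed

lemma is_limit_MInfty_iff: "is_limit F f (-\<infinity>) \<longleftrightarrow> (\<forall>M. \<exists>S\<in>F. \<forall>x\<in>S. f x \<le> M)"
proof
  assume L: "is_limit F f (-\<infinity>)"
  show "\<forall>M. \<exists>S\<in>F. \<forall>x\<in>S. f x \<le> M"
  proof
    fix M
    have M: "-\<infinity> \<in> {..<ereal M}" by simp
    obtain S where S: "S \<in> F" "\<forall>x\<in>S. ereal (f x) \<in> {..<ereal M}"
      using is_limitD[OF L open_lessThan M] by meson
    have "f x \<le> M" if "x \<in> S" for x
      using bspec[OF S(2) that] by simp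
    with S(1) show "\<exists>S\<in>F. \<forall>x\<in>S. f x \<le> M" by blast
  qed
next
  assume R: "\<forall>M. \<exists>S\<in>F. \<forall>x\<in>S. f x \<le> M"
  show "is_limit F f (-\<infinity>)"
  proof (rule is_limitI)
    fix N :: "ereal set" assume "open N" "-\<infinity> \<in> N"
    then obtain M where M: "{..<ereal M} \<subseteq> N" using open_MInfty2 by metis
    obtain S where S: "S \<in> F" "\<forall>x\<in>S. f x \<le> M - 1" using R by meson
    have "ereal (f x) \<in> N" if "x \<in> S" for x
    proof -
      have "f x \<le> M - 1" using S(2) that by blast
      then have "ereal (f x) \<in> {..<ereal M}" by simp
      then show ?thesis using M by blast
    qed
    then show "\<exists>S\<in>F. \<forall>x\<in>S. ereal (f x) \<in> N" using S(1) by blast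
  qed
qed

end

theory Submission
  imports Defs
begin

text \<open>
  On a discrete set the extremal extensions of \<open>\<psi>\<^sub>F\<close> are the limits inferior and superior along the
  filter basis. Every function is order preserving, so \<open>f\<close> may be overwritten by a constant \<open>a\<close> on
  a basis set \<open>S\<close> without leaving the ordered set, and the result lies in the domain of \<open>\<psi>\<^sub>F\<close> with
  value \<open>a\<close>. If \<open>a \<le> f\<close> on \<open>S\<close>, the modified function is below \<open>f\<close>, and hence \<open>a\<close> is a lower bound
  for the lower extension at \<open>f\<close> (\<open>le_lexI\<close>). Conversely the lower extension is the supremum of \<open>\<psi>\<^sub>F\<close>
  over the functions below \<open>f\<close> in its domain, and each of these is constant on a basis set and so
  bounds \<open>f\<close> from below there (\<open>less_lexD\<close>). Therefore the lower extension at \<open>f\<close> is the supremum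
  over \<open>S \<in> F\<close> of the infimum of \<open>f\<close> on \<open>S\<close>, and dually for the upper extension.

  As for ordinary sequences, \<open>f\<close> then converges to \<open>L\<close> exactly if both extremal values equal \<open>L\<close>
  (\<open>is_limit_iff_lex_uex\<close>), from which the theorem can be read off.
\<close>

lemma psi_basis_eq_Some_iff:
  assumes "discrete_set X le" "filter_basis X F"
  shows "psi_basis X le F g = Some c \<longleftrightarrow>
           g \<in> X \<rightarrow>\<^sub>E UNIV \<and> (\<exists>S\<in>F. \<exists>a. c = ereal a \<and> (\<forall>x\<in>S. g x = a))"
proof
  assume c: "psi_basis X le F g = Some c"
  then obtain S where S: "S \<in> F" "g \<in> dom (psi_set X le S)"
    using dom_psi_basis[of X le F] by blast
  have "g \<in> X \<rightarrow>\<^sub>E UNIV"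
    using S(2) OP_discrete[OF assms(1)] by (auto simp: psi_set_def split: if_splits)
  moreover obtain x where "x \<in> S"
    using S(1) assms(2) unfolding filter_basis_def by blast
  moreover have "c = ereal (g y)" if "y \<in> S" for y
    using c psi_basis_eq[OF assms(2) S] psi_set_eq[OF S(2) that] by simp
  ultimately show "g \<in> X \<rightarrow>\<^sub>E UNIV \<and> (\<exists>S\<in>F. \<exists>a. c = ereal a \<and> (\<forall>x\<in>S. g x = a))"
    using S(1) by (metis ereal.inject)
next
  assume R: "g \<in> X \<rightarrow>\<^sub>E UNIV \<and> (\<exists>S\<in>F. \<exists>a. c = ereal a \<and> (\<forall>x\<in>S. g x = a))"
  then obtain S a where S: "S \<in> F" "c = ereal a" "\<forall>x\<in>S. g x = a" by blast
  obtain x where x: "x \<in> S"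
    using S(1) assms(2) unfolding filter_basis_def by blast
  have dom: "g \<in> dom (psi_set X le S)"
    using R S(3) OP_discrete[OF assms(1)] by (auto simp: psi_set_def constant_on_def dom_def)
  show "psi_basis X le F g = Some c"
    using psi_basis_eq[OF assms(2) S(1) dom] psi_set_eq[OF dom x] S(2,3) x by simp
qed

lemma overwrite_const_PiE:
  assumes "filter_basis X F" "S \<in> F" "f \<in> X \<rightarrow>\<^sub>E UNIV"
  shows "(\<lambda>x. if x \<in> S then a else f x) \<in> X \<rightarrow>\<^sub>E UNIV"
  using assms by (fastforce simp: filter_basis_def PiE_def extensional_def)

lemma lex_psi_basis_eq_SUP:
  assumes "discrete_set X le" "filter_basis X F" "f \<in> X \<rightarrow>\<^sub>E UNIV"
  shows "lex (OP X le) (psi_basis X le F) f =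
           (SUP g\<in>{g \<in> dom (psi_basis X le F). g \<le> f}. the (psi_basis X le F g))"
  using assms(3)
  unfolding lex_equality[OF is_lower_extension_Sup[OF partial_function_on_psi_basis[OF assms(2)]]]
  by (simp add: OP_discrete[OF assms(1)])

lemma uex_psi_basis_eq_INF:
  assumes "discrete_set X le" "filter_basis X F" "f \<in> X \<rightarrow>\<^sub>E UNIV"
  shows "uex (OP X le) (psi_basis X le F) f =
           (INF g\<in>{g \<in> dom (psi_basis X le F). f \<le> g}. the (psi_basis X le F g))"
  using assms(3)
  unfolding uex_equality[OF is_upper_extension_Inf[OF partial_function_on_psi_basis[OF assms(2)]]]
  by (simp add: OP_discrete[OF assms(1)])

lemma le_lexI:
  assumes "discrete_set X le" "filter_basis X F" "f \<in> X \<rightarrow>\<^sub>E UNIV"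
    and S: "S \<in> F" "\<And>x. x \<in> S \<Longrightarrow> a \<le> f x"
  shows "ereal a \<le> lex (OP X le) (psi_basis X le F) f"
proof -
  let ?g = "\<lambda>x. if x \<in> S then a else f x"
  have "psi_basis X le F ?g = Some (ereal a)"
    unfolding psi_basis_eq_Some_iff[OF assms(1,2)]
    using overwrite_const_PiE[OF assms(2) S(1) assms(3)] S(1) by auto
  moreover have "?g \<le> f" using S(2) by (simp add: le_fun_def)
  ultimately show ?thesis
    unfolding lex_psi_basis_eq_SUP[OF assms(1-3)] by (intro SUP_upper2[of ?g]) auto
qed

lemma uex_leI:
  assumes "discrete_set X le" "filter_basis X F" "f \<in> X \<rightarrow>\<^sub>E UNIV"
    and S: "S \<in> F" "\<And>x. x \<in> S \<Longrightarrow> f x \<le> a"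
  shows "uex (OP X le) (psi_basis X le F) f \<le> ereal a"
proof -
  let ?g = "\<lambda>x. if x \<in> S then a else f x"
  have "psi_basis X le F ?g = Some (ereal a)"
    unfolding psi_basis_eq_Some_iff[OF assms(1,2)]
    using overwrite_const_PiE[OF assms(2) S(1) assms(3)] S(1) by auto
  moreover have "f \<le> ?g" using S(2) by (simp add: le_fun_def)
  ultimately show ?thesis
    unfolding uex_psi_basis_eq_INF[OF assms(1-3)] by (intro INF_lower2[of ?g]) auto
qed

text \<open>
  A function below \<open>f\<close> witnessing that the supremum exceeds \<open>a\<close> takes a single value larger than \<open>a\<close>
  on some basis set.
\<close>

lemma less_lexD:
  assumes "discrete_set X le" "filter_basis X F" "f \<in> X \<rightarrow>\<^sub>E UNIV"
    and "ereal a < lex (OP X le) (psi_basis X le F) f"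
  shows "\<exists>S\<in>F. \<forall>x\<in>S. a < f x"
proof -
  obtain g c where g: "g \<le> f" "psi_basis X le F g = Some c" "ereal a < c"
    using assms(4) unfolding lex_psi_basis_eq_SUP[OF assms(1-3)] less_SUP_iff by auto
  then obtain S b where S: "S \<in> F" "c = ereal b" "\<forall>x\<in>S. g x = b"
    unfolding psi_basis_eq_Some_iff[OF assms(1,2)] by blast
  have "a < f x" if "x \<in> S" for x
    using le_funD[OF g(1), of x] g(3) S(2,3) that by simp
  then show ?thesis using S(1) by blast
qed

lemma uex_lessD:
  assumes "discrete_set X le" "filter_basis X F" "f \<in> X \<rightarrow>\<^sub>E UNIV"
    and "uex (OP X le) (psi_basis X le F) f < ereal a"
  shows "\<exists>S\<in>F. \<forall>x\<in>S. f x < a"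
proof -
  obtain g c where g: "f \<le> g" "psi_basis X le F g = Some c" "c < ereal a"
    using assms(4) unfolding uex_psi_basis_eq_INF[OF assms(1-3)] INF_less_iff by auto
  then obtain S b where S: "S \<in> F" "c = ereal b" "\<forall>x\<in>S. g x = b"
    unfolding psi_basis_eq_Some_iff[OF assms(1,2)] by blast
  have "f x < a" if "x \<in> S" for x
    using le_funD[OF g(1), of x] g(3) S(2,3) that by simp
  then show ?thesis using S(1) by blast
qed

lemma lex_le_uex_psi_basis:
  assumes "filter_basis X F" "f \<in> OP X le"
  shows "lex (OP X le) (psi_basis X le F) f \<le> uex (OP X le) (psi_basis X le F) f"
proof -
  note P = partial_function_on_psi_basis[OF assms(1), of le]
  show ?thesis
    using is_lower_extension_Sup[OF P] is_upper_extension_Inf[OF P] assms(2)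
    unfolding lex_equality[OF is_lower_extension_Sup[OF P]]
      uex_equality[OF is_upper_extension_Inf[OF P]]
    unfolding is_lower_extension_def is_upper_extension_def by blast
qed

text \<open>
  If \<open>f\<close> converges to \<open>L\<close>, then every real number below \<open>L\<close> bounds \<open>f\<close> from below on a basis set and
  every real number above \<open>L\<close> bounds it from above, which squeezes both extremal values to \<open>L\<close>.
  Conversely, equality of the extremal values yields such bounds on two basis sets, whose
  intersection is again a basis set. For an infinite \<open>L\<close> a single bound suffices.
\<close>

lemma is_limit_iff_lex_uex:
  assumes "discrete_set X le" "filter_basis X F" "f \<in> X \<rightarrow>\<^sub>E UNIV"
  shows "is_limit F f L \<longleftrightarrow>
           lex (OP X le) (psi_basis X le F) f = L \<and> uex (OP X le) (psi_basis X le F) f = L"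
    (is "_ \<longleftrightarrow> ?l = L \<and> ?u = L")
proof
  assume L: "is_limit F f L"
  have "L \<le> ?l"
  proof (rule ccontr)
    assume "\<not> L \<le> ?l"
    then obtain a where a: "?l < ereal a" "ereal a < L"
      using ereal_dense2 not_le by metis
    obtain S where S: "S \<in> F" "\<forall>x\<in>S. ereal (f x) \<in> {ereal a<..}"
      using is_limitD[OF L open_greaterThan, of "ereal a"] a(2) by auto
    have "ereal a \<le> ?l"
      by (rule le_lexI[OF assms S(1)]) (use S(2) in fastforce)
    with a(1) show False by simp
  qed
  moreover have "?u \<le> L"
  proof (rule ccontr)
    assume "\<not> ?u \<le> L"
    then obtain a where a: "L < ereal a" "ereal a < ?u"
      using ereal_dense2 not_le by metis
    obtain S where S: "S \<in> F" "\<forall>x\<in>S. ereal (f x) \<in> {..<ereal a}"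
      using is_limitD[OF L open_lessThan, of "ereal a"] a(1) by auto
    have "?u \<le> ereal a"
      by (rule uex_leI[OF assms S(1)]) (use S(2) in fastforce)
    with a(2) show False by simp
  qed
  moreover have "?l \<le> ?u"
    using lex_le_uex_psi_basis[OF assms(2)] OP_discrete[OF assms(1)] assms(3) by blast
  ultimately show "?l = L \<and> ?u = L" by (meson order_antisym order_trans)
next
  assume R: "?l = L \<and> ?u = L"
  show "is_limit F f L"
  proof (cases L)
    case (real r)
    show ?thesis
      unfolding real is_limit_ereal_iff
    proof (intro allI impI)
      fix e :: real assume e: "e > 0"
      obtain S where S: "S \<in> F" "\<forall>x\<in>S. r - e < f x"
        using less_lexD[OF assms, of "r - e"] R real e by auto
      obtain T where T: "T \<in> F" "\<forall>x\<in>T. f x < r + e"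
        using uex_lessD[OF assms, of "r + e"] R real e by auto
      show "\<exists>S\<in>F. \<forall>x\<in>S. f x \<in> {r - e..r + e}"
        using filter_basis_Int(1)[OF assms(2) S(1) T(1)] S(2) T(2) by (intro bexI[of _ "S \<inter> T"]) auto
    qed
  next
    case PInf
    show ?thesis
      unfolding PInf is_limit_PInfty_iff
    proof
      fix M
      show "\<exists>S\<in>F. \<forall>x\<in>S. f x \<ge> M"
        using less_lexD[OF assms, of M] R PInf less_imp_le by fastforce
    qed
  next
    case MInf
    show ?thesis
      unfolding MInf is_limit_MInfty_iff
    proof
      fix M
      show "\<exists>S\<in>F. \<forall>x\<in>S. f x \<le> M"
        using uex_lessD[OF assms, of M] R MInf less_imp_le by fastforce
    qed
  qed
qed

theorem theorem7p3:
  fixes X :: "'a set" and le :: "'a \<Rightarrow> 'a \<Rightarrow> bool" and F :: "'a set set"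
  assumes "discrete_set X le" and "filter_basis X F"
  shows "(\<forall>f \<in> X \<rightarrow>\<^sub>E (UNIV :: real set).
            F_convergent F f \<longleftrightarrow> f \<in> Dar (OP X le) (psi_basis X le F)) \<and>
         (\<forall>f \<in> Dar (OP X le) (psi_basis X le F).
            ex_ext (OP X le) (psi_basis X le F) f = F_lim F f)"
proof (intro conjI ballI)
  fix f assume f: "f \<in> X \<rightarrow>\<^sub>E (UNIV :: real set)"
  show "F_convergent F f \<longleftrightarrow> f \<in> Dar (OP X le) (psi_basis X le F)"
    using f OP_discrete[OF assms(1)]
    by (auto simp: F_convergent_def Dar_def is_limit_iff_lex_uex[OF assms f])
next
  fix f assume D: "f \<in> Dar (OP X le) (psi_basis X le F)"
  then have f: "f \<in> X \<rightarrow>\<^sub>E UNIV"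
    using OP_discrete[OF assms(1)] by (auto simp: Dar_def)
  have "is_limit F f (lex (OP X le) (psi_basis X le F) f)"
    using D by (simp add: is_limit_iff_lex_uex[OF assms f] Dar_def)
  then show "ex_ext (OP X le) (psi_basis X le F) f = F_lim F f"
    using D F_lim_equality[OF assms(2)] by (simp add: ex_ext_def)
qed

end
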